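(* There exist a Banach space $X$ and $T_1,T_2\in\mathfrak L(X)$ such that $(T_1,T_2)$ is $d$-frequently hypercyclic but not densely $d$-hypercyclic.
   Context: $(T_1,T_2)$ is $d$-frequently hypercyclic if there is $x\in X$ such that for every non-empty open $W\subset X\times X$ the set $\{n\in\mathbb N:(T_1^nx,T_2^nx)\in W\}$ has positive lower density. A vector $x$ is $d$-hypercyclic for $(T_1,T_2)$ if $\{(T_1^nx,T_2^nx):n\ge0\}$ is dense in $X\times X$; the pair is densely $d$-hypercyclic if the set of $d$-hypercyclic vectors is dense in $X$. *)

theory Defs
  imports "HOL-Analysis.Analysis"
begin

text \<open>Ambient space: real l-infinity, realised as bounded (continuous) functions on the
  discrete space nat. Every separable real Banach space is linearly isometric to a closed
  linear subspace of it, so "a Banach space X" is rendered as a closed linear subspace X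
  of this ambient Banach space, with the induced norm and topology.\<close>

type_synonym linf = "(nat, real) bcontfun"

definition bounded_linear_on :: "'a::real_normed_vector set \<Rightarrow> ('a \<Rightarrow> 'a) \<Rightarrow> bool" where
  "bounded_linear_on X T \<longleftrightarrow>
     (\<forall>x\<in>X. T x \<in> X) \<and>
     (\<forall>x\<in>X. \<forall>y\<in>X. T (x + y) = T x + T y) \<and>
     (\<forall>c::real. \<forall>x\<in>X. T (c *\<^sub>R x) = c *\<^sub>R T x) \<and>
     (\<exists>C. \<forall>x\<in>X. norm (T x) \<le> C * norm x)"

definition pos_lower_density :: "nat set \<Rightarrow> bool" where
  "pos_lower_density A \<longleftrightarrow>
     liminf (\<lambda>n. ereal (real (card (A \<inter> {1..n})) / real n)) > 0"

definition open_pair_sets :: "'a::real_normed_vector set \<Rightarrow> ('a \<times> 'a) set set" where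
  "open_pair_sets X =
     {W. openin (prod_topology (top_of_set X) (top_of_set X)) W \<and> W \<noteq> {}}"

definition d_hypercyclic_vector ::
  "'a::real_normed_vector set \<Rightarrow> ('a \<Rightarrow> 'a) \<Rightarrow> ('a \<Rightarrow> 'a) \<Rightarrow> 'a \<Rightarrow> bool" where
  "d_hypercyclic_vector X T1 T2 x \<longleftrightarrow> x \<in> X \<and>
     (prod_topology (top_of_set X) (top_of_set X)) closure_of
        {((T1 ^^ n) x, (T2 ^^ n) x) | n. True} = X \<times> X"

definition densely_d_hypercyclic ::
  "'a::real_normed_vector set \<Rightarrow> ('a \<Rightarrow> 'a) \<Rightarrow> ('a \<Rightarrow> 'a) \<Rightarrow> bool" where
  "densely_d_hypercyclic X T1 T2 \<longleftrightarrow>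
     (top_of_set X) closure_of {x. d_hypercyclic_vector X T1 T2 x} = X"

definition d_frequently_hypercyclic ::
  "'a::real_normed_vector set \<Rightarrow> ('a \<Rightarrow> 'a) \<Rightarrow> ('a \<Rightarrow> 'a) \<Rightarrow> bool" where
  "d_frequently_hypercyclic X T1 T2 \<longleftrightarrow>
     (\<exists>x\<in>X. \<forall>W\<in>open_pair_sets X.
        pos_lower_density {n. ((T1 ^^ n) x, (T2 ^^ n) x) \<in> W})"

end

theory Submission
  imports Defs
begin

text \<open>Let \<open>T\<close> be twice the backward shift on \<open>X = c\<^sub>0\<close> and let \<open>T\<^sub>1 = T\<close>, \<open>T\<^sub>2 = S\<^sup>-\<^sup>1 T S\<close> with
  \<open>S y = y + y\<^sub>0 e + y\<^sub>1 k\<close>, where \<open>e, k\<close> vanish at 0 and 1, so that \<open>S - I\<close> squares to 0.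
  Then the joint orbit of \<open>y\<close> under \<open>(T\<^sub>1, T\<^sub>2)\<close> has the same density behaviour as that of
  \<open>(y, S y - y)\<close> under \<open>T \<oplus> T\<close>.
  If \<open>(x, e)\<close> is frequently hypercyclic for \<open>T \<oplus> T\<close> and \<open>x\<^sub>0 = 1\<close>, \<open>x\<^sub>1 = 0\<close>, then \<open>S x - x = e\<close>
  and \<open>x\<close> is d-frequently hypercyclic. Choosing \<open>k\<^sub>m = \<bar>e\<^sub>m\<bar> + 2\<^sup>-\<^sup>m\<close>, the orbit of \<open>y\<^sub>0 e + y\<^sub>1 k\<close> stays
  away from 0 whenever \<open>\<bar>y\<^sub>0\<bar> < \<bar>y\<^sub>1\<bar>\<close>, so an open set contains no d-hypercyclic vector.
  The pair \<open>(x, e)\<close> is built by writing every pair of finite rational words, suitably rescaled,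
  at positions of positive lower density.\<close>

section \<open>Block positions of positive lower density\<close>

text \<open>Ones at the end of the binary expansion: every value recurs along an arithmetic
  progression, yet the average stays bounded.\<close>

function trailing_ones :: "nat \<Rightarrow> nat" where
  "trailing_ones n = (if even n then 0 else Suc (trailing_ones (n div 2)))"
  by auto
termination
  by (relation "Wellfounded.measure id") (auto elim!: oddE)

declare trailing_ones.simps [simp del]

lemma trailing_ones_double [simp]: "trailing_ones (2 * n) = 0"
  by (simp add: trailing_ones.simps)

lemma trailing_ones_0 [simp]: "trailing_ones 0 = 0"
  by (simp add: trailing_ones.simps)

lemma trailing_ones_double_Suc [simp]: "trailing_ones (Suc (2 * n)) = Suc (trailing_ones n)"
  by (subst trailing_ones.simps) simp

text \<open>In binary the argument is \<open>t\<close> followed by one 0 and \<open>k\<close> digits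
  1; the induction appends a further 1.\<close>

lemma trailing_ones_eq: "trailing_ones (2 ^ Suc k * t + 2 ^ k - 1) = k"
proof (induction k)
  case (Suc k)
  obtain c where "(2::nat) ^ k = Suc c" by (metis not0_implies_Suc power_not_zero zero_neq_numeral)
  then have "2 ^ Suc (Suc k) * t + 2 ^ Suc k - 1 = Suc (2 * (2 ^ Suc k * t + 2 ^ k - 1))"
    by simp
  then show ?case using Suc by simp
qed simp

definition trailing_sum :: "nat \<Rightarrow> nat" where
  "trailing_sum n = (\<Sum>i<n. trailing_ones i)"

lemma trailing_sum_0 [simp]: "trailing_sum 0 = 0"
  by (simp add: trailing_sum_def)

lemma trailing_sum_Suc [simp]: "trailing_sum (Suc n) = trailing_sum n + trailing_ones n"
  by (simp add: trailing_sum_def)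

lemma trailing_sum_double: "trailing_sum (2 * n) = trailing_sum n + n"
  by (induction n) simp_all

text \<open>Even arguments contribute nothing, so summing up to \<open>2 * m\<close> gives the sum
  up to \<open>m\<close> plus \<open>m\<close>; strong induction on the half closes.\<close>

lemma trailing_sum_le: "trailing_sum n \<le> n"
proof (induction n rule: less_induct)
  case (less n)
  show ?case
  proof (cases "even n")
    case True
    then obtain m where m: "n = 2 * m" by blast
    show ?thesis
    proof (cases "m = 0")
      case False
      then show ?thesis using less[of m] m by (simp add: trailing_sum_double)
    qed (use m in simp)
  next
    case False
    then obtain m where m: "n = Suc (2 * m)" by (metis oddE Suc_eq_plus1)
    then show ?thesis using less[of m] by (simp add: trailing_sum_double)
  qed
qed

lemma trailing_sum_mono: "m \<le> n \<Longrightarrow> trailing_sum m \<le> trailing_sum n"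
  unfolding trailing_sum_def by (intro sum_mono2) auto

text \<open>The offset 2 keeps coordinates 0 and 1 free. The two overlapping sums make the step from
  \<open>j\<close> to \<open>Suc j\<close> equal to
  \<open>1 + trailing_ones j + trailing_ones (Suc j)\<close>.\<close>

definition block_pos :: "nat \<Rightarrow> nat" where
  "block_pos j = 2 + j + trailing_sum j + trailing_sum (Suc j)"

text \<open>Block \<open>j\<close> will carry the word with index \<open>trailing_ones j\<close>. The gap between two blocks exceeds
  the sum of their indices, yet the positions grow linearly because the indices are bounded on
  average.\<close>

lemma block_pos_gap:
  assumes "i < j"
  shows "block_pos i + trailing_ones i + trailing_ones j < block_pos j"
  using assms trailing_sum_mono[of i j] trailing_sum_mono[of "Suc i" j]
  by (simp add: block_pos_def)

lemma block_pos_le: "block_pos j \<le> 3 * Suc j"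
  using trailing_sum_le[of j] trailing_sum_le[of "Suc j"] by (simp add: block_pos_def)

lemma block_pos_ge: "2 + j + trailing_ones j \<le> block_pos j"
  by (simp add: block_pos_def)

lemma strict_mono_block_pos: "strict_mono block_pos"
  using block_pos_gap by (intro strict_monoI) (metis add_lessD1)

text \<open>For \<open>p\<close> at least 2 the greatest \<open>j\<close> exists, as block 0 starts
  at 2 and \<open>j\<close> never exceeds \<open>block_pos j\<close>. Smaller \<open>p\<close> are
  treated separately in \<open>glue\<close>.\<close>

definition block :: "nat \<Rightarrow> nat" where
  "block p = (GREATEST j. block_pos j \<le> p)"

lemma le_block_pos: "j \<le> block_pos j"
  using block_pos_ge[of j] by linarith

lemma block_pos_block:
  assumes "2 \<le> p"
  shows "block_pos (block p) \<le> p"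
proof -
  have "block_pos 0 \<le> p" using assms by (simp add: block_pos_def)
  then show ?thesis
    unfolding block_def by (rule GreatestI_nat[where b = p]) (rule order_trans[OF le_block_pos])
qed

lemma le_block: "block_pos j \<le> p \<Longrightarrow> j \<le> block p"
  unfolding block_def by (rule Greatest_le_nat[where b = p]) (assumption, rule order_trans[OF le_block_pos])

text \<open>Otherwise the next block would already have started by \<open>p\<close>, against
  maximality. This forces the block index to infinity.\<close>

lemma block_lower: "p \<le> 3 * block p + 6"
proof (rule ccontr)
  assume "\<not> ?thesis"
  then have "block_pos (Suc (block p)) \<le> p"
    using block_pos_le[of "Suc (block p)"] by simp
  then show False using le_block by fastforce
qed

text \<open>The times at which the backward shift brings a copy of word \<open>k\<close> to the
  front.\<close>

definition hits :: "nat \<Rightarrow> nat set" where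
  "hits k = block_pos ` {j. trailing_ones j = k}"

text \<open>The subsequence \<open>g\<close> of \<open>hits k\<close> grows at most linearly: blocks
  of index \<open>k\<close> recur with period \<open>2 ^ Suc k\<close>, and positions grow at rate
  at most 3.\<close>

lemma pos_lower_density_hits:
  assumes "hits k \<subseteq> A"
  shows "pos_lower_density A"
proof -
  define g where "g t = block_pos (2 ^ Suc k * t + 2 ^ k - 1)" for t
  define D :: nat where "D = 3 * 2 ^ Suc k"
  have "inj g"
  proof (rule injI)
    fix s t
    assume "g s = g t"
    then have "2 ^ Suc k * s + 2 ^ k - 1 = 2 ^ Suc k * t + 2 ^ k - (1::nat)"
      unfolding g_def using strict_mono_eq[OF strict_mono_block_pos] by blast
    then have "2 ^ Suc k * s = 2 ^ Suc k * t"
      using one_le_power[of "2::nat" k] by linarith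
    then show "s = t" by simp
  qed
  have g_A: "g t \<in> A" for t
    using assms trailing_ones_eq[of k t] unfolding hits_def g_def by blast
  have g_le: "g t \<le> D * Suc t" for t
  proof -
    have "g t \<le> 3 * (2 ^ Suc k * t + 2 ^ k)"
      unfolding g_def using block_pos_le[of "2 ^ Suc k * t + 2 ^ k - 1"]
        one_le_power[of "2::nat" k] by simp
    then show ?thesis by (simp add: D_def algebra_simps)
  qed
  have g_ge: "1 \<le> g t" for t
    by (simp add: g_def block_pos_def)
  have count: "n div D \<le> card (A \<inter> {1..n})" for n
  proof -
    have "g ` {..<n div D} \<subseteq> A \<inter> {1..n}"
    proof safe
      fix t assume "t < n div D"
      then have "D * Suc t \<le> D * (n div D)" by (intro mult_le_mono) auto
      also have "\<dots> \<le> n" by simp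
      finally show "g t \<in> {1..n}" using g_le[of t] g_ge[of t] by simp
    qed (use g_A in auto)
    then have "card (g ` {..<n div D}) \<le> card (A \<inter> {1..n})"
      by (intro card_mono) auto
    then show ?thesis using \<open>inj g\<close> by (simp add: card_image inj_on_subset)
  qed
  have D: "D > 0" by (simp add: D_def)
  \<comment> \<open>From \<open>2 * D\<close> on, rounding down in \<open>n div D\<close> loses at
    most half of \<open>n / D\<close>.\<close>
  have "eventually (\<lambda>n. ereal (1 / (2 * D)) \<le> ereal (real (card (A \<inter> {1..n})) / real n)) sequentially"
    using eventually_ge_at_top[of "2 * D"]
  proof eventually_elim
    case (elim n)
    have "n < D * (n div D) + D"
      using D by (metis add.commute mod_less_divisor mult_div_mod_eq nat_add_left_cancel_less)
    then have "n \<le> 2 * (D * (n div D))" using elim by linarith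
    also have "\<dots> \<le> 2 * (D * card (A \<inter> {1..n}))" using count by simp
    finally have "real n \<le> real (2 * (D * card (A \<inter> {1..n})))" by linarith
    then show ?case using D elim by (simp add: field_simps)
  qed
  then have "ereal (1 / (2 * D)) \<le> liminf (\<lambda>n. ereal (real (card (A \<inter> {1..n})) / real n))"
    by (rule Liminf_bounded)
  moreover have "0 < ereal (1 / (2 * D))" using D by simp
  ultimately show ?thesis unfolding pos_lower_density_def by (rule less_le_trans[rotated])
qed

section \<open>Gluing words into one sequence\<close>

text \<open>The divisor cancels the factor \<open>2 ^ n\<close> that the \<open>n\<close>-th iterate
  of the doubled shift produces at \<open>n = block_pos j\<close>.\<close>

definition glue :: "(nat \<Rightarrow> nat \<Rightarrow> real) \<Rightarrow> nat \<Rightarrow> real" where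
  "glue a p = (if p < 2 then 0
     else a (trailing_ones (block p)) (p - block_pos (block p)) / 2 ^ block_pos (block p))"

text \<open>Agreement is exact until the next block starts. From there on word \<open>j\<close> has
  ended, and the gap keeps later entries small even after multiplication by
  \<open>2 ^ block_pos j\<close>.\<close>

lemma glue_approx:
  assumes bound: "\<And>k i. \<bar>a k i\<bar> \<le> 2 ^ k" and supp: "\<And>k i. k < i \<Longrightarrow> a k i = 0"
  shows "\<bar>2 ^ block_pos j * glue a (block_pos j + i) - a (trailing_ones j) i\<bar>
           \<le> 1 / 2 ^ trailing_ones j"
proof -
  define p where "p = block_pos j + i"
  define b where "b = block p"
  have p2: "2 \<le> p" by (simp add: p_def block_pos_def)
  have "j \<le> b" unfolding b_def by (rule le_block) (simp add: p_def)
  then consider "b = j" | "j < b" by linarith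
  then show ?thesis
  proof cases
    case 1
    then show ?thesis using p2 by (simp add: glue_def p_def b_def)
  next
    case 2
    let ?k = "trailing_ones j" and ?l = "trailing_ones b"
    have gap: "block_pos j + ?k + ?l < block_pos b" using 2 by (rule block_pos_gap)
    then have "?k < i" using block_pos_block[OF p2] by (simp add: b_def p_def)
    then have "a ?k i = 0" by (rule supp)
    moreover have "\<bar>2 ^ block_pos j * glue a p\<bar> \<le> 1 / 2 ^ ?k"
    proof -
      have "\<bar>2 ^ block_pos j * glue a p\<bar> \<le> 2 ^ block_pos j * (2 ^ ?l / 2 ^ block_pos b)"
        using bound[of ?l "p - block_pos b"] p2
        by (auto simp: glue_def b_def[symmetric] abs_mult divide_right_mono)
      also have "\<dots> = 2 ^ (block_pos j + ?k + ?l) / (2 ^ block_pos b * 2 ^ ?k)"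
        by (simp add: power_add)
      also have "\<dots> \<le> 2 ^ block_pos b / (2 ^ block_pos b * 2 ^ ?k)"
        using gap by (intro divide_right_mono power_increasing) auto
      finally show ?thesis by simp
    qed
    ultimately show ?thesis by (simp add: p_def)
  qed
qed

text \<open>Since \<open>block_pos b\<close> is at least \<open>b + trailing_ones b\<close>, entries
  of block \<open>b\<close> are at most \<open>(1 / 2) ^ b\<close>.\<close>

lemma glue_tendsto_0:
  assumes bound: "\<And>k i. \<bar>a k i\<bar> \<le> 2 ^ k"
  shows "glue a \<longlonglongrightarrow> 0"
proof -
  have "filterlim block at_top sequentially"
    unfolding filterlim_at_top
  proof
    fix Z :: nat
    show "eventually (\<lambda>p. Z \<le> block p) sequentially"
      using eventually_ge_at_top[of "3 * Z + 6"]
    proof eventually_elim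
      case (elim p)
      then show ?case using block_lower[of p] by linarith
    qed
  qed
  then have lim: "(\<lambda>p. (1 / 2) ^ block p :: real) \<longlonglongrightarrow> 0"
    by (rule filterlim_compose[OF LIMSEQ_realpow_zero, rotated 2]) auto
  show ?thesis
  proof (rule Lim_null_comparison[OF _ lim], rule always_eventually, rule allI)
    fix p
    let ?b = "block p"
    have "\<bar>glue a p\<bar> \<le> 2 ^ trailing_ones ?b / 2 ^ block_pos ?b"
      using bound[of "trailing_ones ?b" "p - block_pos ?b"]
      by (auto simp: glue_def divide_right_mono)
    also have "\<dots> \<le> 2 ^ trailing_ones ?b / 2 ^ (?b + trailing_ones ?b)"
      using block_pos_ge[of ?b] by (intro divide_left_mono power_increasing) auto
    also have "\<dots> = (1 / 2) ^ ?b" by (simp add: power_add power_divide)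
    finally show "norm (glue a p) \<le> (1 / 2) ^ block p" by simp
  qed
qed

section \<open>Finite rational words\<close>

definition padded :: "rat list \<Rightarrow> nat \<Rightarrow> real" where
  "padded l i = (if i < length l then real_of_rat (l ! i) else 0)"

text \<open>Cutting off words that are too long or too large for their index costs nothing, as each
  word occurs with arbitrarily large indices.\<close>

definition small_word :: "nat \<Rightarrow> rat list \<Rightarrow> nat \<Rightarrow> real" where
  "small_word k l = (if length l \<le> k \<and> (\<forall>i. \<bar>padded l i\<bar> \<le> 2 ^ k) then padded l else (\<lambda>_. 0))"

lemma small_word_le: "\<bar>small_word k l i\<bar> \<le> 2 ^ k"
  by (simp add: small_word_def)

lemma small_word_supp: "k < i \<Longrightarrow> small_word k l i = 0"
  by (simp add: small_word_def padded_def)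

lemma small_word_eventually: "eventually (\<lambda>k. small_word k l = padded l) sequentially"
proof -
  have "\<bar>padded l i\<bar> \<le> (\<Sum>i<length l. \<bar>padded l i\<bar>)" for i
    by (cases "i < length l") (auto simp: padded_def sum_nonneg intro!: member_le_sum)
  moreover obtain n where "(\<Sum>i<length l. \<bar>padded l i\<bar>) < 2 ^ n"
    using real_arch_pow[of 2] by auto
  ultimately have less: "\<bar>padded l i\<bar> \<le> 2 ^ n" for i by (meson less_imp_le order_trans)
  have "\<bar>padded l i\<bar> \<le> 2 ^ k" if "n \<le> k" for i k
    by (rule order_trans[OF less]) (use that in \<open>simp add: power_increasing\<close>)
  then have "small_word k l = padded l" if "max n (length l) \<le> k" for k
    using that by (simp add: small_word_def)
  then show ?thesis unfolding eventually_sequentially by blast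
qed

text \<open>Rational approximation up to \<open>N\<close>, where the tail of \<open>u\<close>
  becomes smaller than \<open>d\<close>, and zeros afterwards.\<close>

lemma padded_dense:
  fixes u :: "nat \<Rightarrow> real"
  assumes "u \<longlonglongrightarrow> 0" "0 < d"
  obtains l where "\<And>i. \<bar>padded l i - u i\<bar> < d"
proof -
  obtain N where N: "\<And>i. N \<le> i \<Longrightarrow> \<bar>u i\<bar> < d"
    using assms unfolding LIMSEQ_def by (auto simp: dist_real_def)
  have "\<exists>q. \<bar>real_of_rat q - u i\<bar> < d" for i
  proof -
    obtain q where "u i < real_of_rat q" "real_of_rat q < u i + d"
      using of_rat_dense[of "u i" "u i + d"] assms(2) by auto
    then show ?thesis by (intro exI[of _ q]) linarith
  qed
  then obtain q where q: "\<And>i. \<bar>real_of_rat (q i) - u i\<bar> < d" by metis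
  have "\<bar>padded (map q [0..<N]) i - u i\<bar> < d" for i
    using q[of i] N[of i] by (simp add: padded_def)
  then show ?thesis by (rule that)
qed

section \<open>Operators on null sequences\<close>

definition c0 :: "linf set" where
  "c0 = {y. apply_bcontfun y \<longlonglongrightarrow> 0}"

lemma subspace_c0: "subspace c0"
  unfolding subspace_def c0_def
  by (auto simp: plus_bcontfun.rep_eq zero_bcontfun.rep_eq scaleR_bcontfun.rep_eq
      intro: tendsto_add_zero tendsto_mult_right_zero)

lemma closed_c0: "closed c0"
  unfolding closed_sequential_limits
proof (intro allI impI, elim conjE)
  fix f :: "nat \<Rightarrow> linf" and l
  assume f: "\<forall>n. f n \<in> c0" and lim: "f \<longlonglongrightarrow> l"
  have "((\<lambda>i. apply_bcontfun l i) \<longlongrightarrow> 0) sequentially"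
  proof (rule swap_uniform_limit'[where F = sequentially and G = sequentially and f = "\<lambda>n. apply_bcontfun (f n)" and g = "\<lambda>_. 0"])
    show "uniform_limit UNIV (\<lambda>n. apply_bcontfun (f n)) (apply_bcontfun l) sequentially"
      by (rule tendsto_bcontfun_uniform_limit[OF lim])
  qed (use f in \<open>auto simp: c0_def\<close>)
  then show "l \<in> c0" by (simp add: c0_def)
qed

lemma null_seq_bcontfun:
  fixes f :: "nat \<Rightarrow> real"
  assumes "f \<longlonglongrightarrow> 0"
  obtains y where "y \<in> c0" "apply_bcontfun y = f"
proof -
  have "bounded (range f)" using assms by (intro convergent_imp_bounded)
  then have "f \<in> bcontfun" by (simp add: bcontfun_def)
  then have "apply_bcontfun (Bcontfun f) = f" by (rule Bcontfun_inverse)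
  then show ?thesis using assms that by (auto simp: c0_def)
qed

section \<open>Twice the backward shift (Rolewicz's operator)\<close>

definition doubled_shift :: "linf \<Rightarrow> linf" where
  "doubled_shift y = Bcontfun (\<lambda>i. 2 * apply_bcontfun y (Suc i))"

lemma apply_doubled_shift [simp]: "apply_bcontfun (doubled_shift y) = (\<lambda>i. 2 * apply_bcontfun y (Suc i))"
proof -
  have "bounded ((\<lambda>r. 2 * r) ` range (apply_bcontfun y))"
    by (intro bounded_linear_image bounded_linear_mult_right) simp
  then have "bounded (range (\<lambda>i. 2 * apply_bcontfun y (Suc i)))" by (rule bounded_subset) auto
  then have "(\<lambda>i. 2 * apply_bcontfun y (Suc i)) \<in> bcontfun" by (simp add: bcontfun_def)
  then show ?thesis by (simp add: doubled_shift_def Bcontfun_inverse)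
qed

lemma apply_doubled_shift_funpow:
  "apply_bcontfun ((doubled_shift ^^ n) y) i = 2 ^ n * apply_bcontfun y (n + i)"
  by (induction n arbitrary: i) simp_all

lemma bounded_linear_apply_bcontfun:
  "bounded_linear (\<lambda>y :: 'a::topological_space \<Rightarrow>\<^sub>C 'b::real_normed_vector. apply_bcontfun y i)"
  by (rule bounded_linear_intro[where K = 1])
    (auto simp: plus_bcontfun.rep_eq scaleR_bcontfun.rep_eq norm_bounded)

lemma bounded_linear_doubled_shift: "bounded_linear doubled_shift"
proof (rule bounded_linear_intro[where K = 2])
  show "norm (doubled_shift y) \<le> norm y * 2" for y
    using norm_bounded[of y] by (intro norm_bound) (simp add: abs_mult mult.commute)
qed (auto intro!: bcontfun_eqI simp: plus_bcontfun.rep_eq scaleR_bcontfun.rep_eq algebra_simps)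

lemma bounded_linear_doubled_shift_funpow: "bounded_linear (doubled_shift ^^ n)"
proof (induction n)
  case (Suc n)
  then show ?case
    using bounded_linear_compose[OF bounded_linear_doubled_shift] by (simp add: comp_def)
qed (simp add: id_def bounded_linear_ident)

lemma doubled_shift_c0: "y \<in> c0 \<Longrightarrow> doubled_shift y \<in> c0"
  using tendsto_mult_right_zero[OF LIMSEQ_Suc[of "apply_bcontfun y" 0], of 2] by (simp add: c0_def)

lemma doubled_shift_funpow_c0: "y \<in> c0 \<Longrightarrow> (doubled_shift ^^ n) y \<in> c0"
  by (induction n) (auto intro: doubled_shift_c0)

lemma bounded_linear_on_if_bounded_linear:
  assumes "bounded_linear T" "\<And>x. x \<in> X \<Longrightarrow> T x \<in> X"
  shows "bounded_linear_on X T"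
proof -
  obtain K where "\<And>x. norm (T x) \<le> norm x * K"
    using bounded_linear.bounded[OF assms(1)] by blast
  then show ?thesis
    using assms(2) bounded_linear.linear[OF assms(1)]
    unfolding bounded_linear_on_def
    by (auto simp: linear_add linear_scale mult.commute)
qed

section \<open>Shears and conjugation\<close>

definition shear :: "linf \<Rightarrow> linf \<Rightarrow> linf \<Rightarrow> linf" where
  "shear e k y = y + apply_bcontfun y 0 *\<^sub>R e + apply_bcontfun y 1 *\<^sub>R k"

lemma apply_shear:
  "apply_bcontfun (shear e k y) i
     = apply_bcontfun y i + apply_bcontfun y 0 * apply_bcontfun e i
       + apply_bcontfun y 1 * apply_bcontfun k i"
  by (simp add: shear_def plus_bcontfun.rep_eq scaleR_bcontfun.rep_eq)

lemma bounded_linear_shear: "bounded_linear (shear e k)"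
  unfolding shear_def
  by (intro bounded_linear_add bounded_linear_ident bounded_linear_scaleR_const
      bounded_linear_apply_bcontfun)

lemma shear_c0: "e \<in> c0 \<Longrightarrow> k \<in> c0 \<Longrightarrow> y \<in> c0 \<Longrightarrow> shear e k y \<in> c0"
  unfolding shear_def by (intro subspace_add subspace_scale subspace_c0)

text \<open>The added term depends only on coordinates 0 and 1, which it leaves unchanged, so
  subtracting it again undoes the shear.\<close>

lemma shear_shear_minus:
  assumes "apply_bcontfun e 0 = 0" "apply_bcontfun e 1 = 0"
    and "apply_bcontfun k 0 = 0" "apply_bcontfun k 1 = 0"
  shows "shear e k (shear (- e) (- k) y) = y" "shear (- e) (- k) (shear e k y) = y"
  using assms
  by (auto intro!: bcontfun_eqI simp: apply_shear uminus_bcontfun.rep_eq)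

lemma funpow_conjugate:
  assumes "\<And>y. g (h y) = y" "\<And>y. h (g y) = y"
  shows "((\<lambda>y. h (f (g y))) ^^ n) y = h ((f ^^ n) (g y))"
  by (induction n) (simp_all add: assms)

lemma frequently_approximating_pair:
  obtains x e where "x \<in> c0" "apply_bcontfun x 0 = 1" "apply_bcontfun x 1 = 0"
    and "e \<in> c0" "apply_bcontfun e 0 = 0" "apply_bcontfun e 1 = 0"
    and "\<And>u v d. u \<in> c0 \<Longrightarrow> v \<in> c0 \<Longrightarrow> 0 < d \<Longrightarrow>
      \<exists>k. \<forall>n\<in>hits k. dist ((doubled_shift ^^ n) x) u < d \<and> dist ((doubled_shift ^^ n) e) v < d"
proof -
  \<comment> \<open>The third component of the triple is a dummy that gives each pair of words
    infinitely many indices.\<close>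
  define a where "a k = small_word k (fst (from_nat k :: rat list \<times> rat list \<times> nat))" for k
  define b where "b k = small_word k (fst (snd (from_nat k :: rat list \<times> rat list \<times> nat)))" for k
  have a_le: "\<bar>a k i\<bar> \<le> 2 ^ k" and b_le: "\<bar>b k i\<bar> \<le> 2 ^ k" for k i
    by (simp_all add: a_def b_def small_word_le)
  have a_supp: "k < i \<Longrightarrow> a k i = 0" and b_supp: "k < i \<Longrightarrow> b k i = 0" for k i
    by (simp_all add: a_def b_def small_word_supp)
  \<comment> \<open>Setting coordinate 0 to 1 does no harm: hits are at least 2, so the shift
    discards it.\<close>
  have "(\<lambda>i. glue a i + (if i = 0 then 1 else 0)) \<longlonglongrightarrow> 0"
  proof (rule Lim_transform_eventually[OF glue_tendsto_0[of a, OF a_le]])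
    show "eventually (\<lambda>i. glue a i = glue a i + (if i = 0 then 1 else 0)) sequentially"
      using eventually_gt_at_top[of 0] by eventually_elim simp
  qed
  then obtain x where x: "x \<in> c0" "apply_bcontfun x = (\<lambda>i. glue a i + (if i = 0 then 1 else 0))"
    by (rule null_seq_bcontfun)
  obtain e where e: "e \<in> c0" "apply_bcontfun e = glue b"
    using null_seq_bcontfun[OF glue_tendsto_0[of b, OF b_le]] .
  have approx: "dist ((doubled_shift ^^ n) y) u < d"
    if y: "\<And>i. 2 \<le> i \<Longrightarrow> apply_bcontfun y i = glue c i"
      and c: "\<And>k i. \<bar>c k i\<bar> \<le> 2 ^ k" "\<And>k i. k < i \<Longrightarrow> c k i = 0"
      and n: "n \<in> hits k" and d: "1 / 2 ^ k < d / 3" "0 < d"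
      and u: "\<And>i. \<bar>c k i - apply_bcontfun u i\<bar> < d / 3" for y u c n k d
  proof -
    obtain j where j: "n = block_pos j" "k = trailing_ones j" using n by (auto simp: hits_def)
    \<comment> \<open>One third for the gluing error and one for the rational approximation; the
      spare third restores strictness, as the supremum only gives a weak bound.\<close>
    have "dist ((doubled_shift ^^ n) y) u \<le> d / 3 + d / 3"
    proof (rule dist_bound)
      fix i
      have "apply_bcontfun y (n + i) = glue c (n + i)" by (rule y) (simp add: j block_pos_def)
      then have "\<bar>apply_bcontfun ((doubled_shift ^^ n) y) i - c k i\<bar> \<le> 1 / 2 ^ k"
        using glue_approx[of c j i, OF c] by (simp add: apply_doubled_shift_funpow j)
      then show "dist (apply_bcontfun ((doubled_shift ^^ n) y) i) (apply_bcontfun u i) \<le> d / 3 + d / 3"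
        using u[of i] d(1) unfolding dist_real_def by linarith
    qed
    then show ?thesis using d(2) by linarith
  qed
  show ?thesis
  proof (rule that[of x e])
    fix u v :: linf and d :: real
    assume uv: "u \<in> c0" "v \<in> c0" and d: "0 < d"
    then have "0 < d / 3" by simp
    obtain l where l: "\<And>i. \<bar>padded l i - apply_bcontfun u i\<bar> < d / 3"
      using padded_dense[of "apply_bcontfun u" "d / 3"] uv(1) \<open>0 < d / 3\<close> unfolding c0_def by blast
    obtain m where m: "\<And>i. \<bar>padded m i - apply_bcontfun v i\<bar> < d / 3"
      using padded_dense[of "apply_bcontfun v" "d / 3"] uv(2) \<open>0 < d / 3\<close> unfolding c0_def by blast
    have "(\<lambda>k. (1 / 2 :: real) ^ k) \<longlonglongrightarrow> 0" by (rule LIMSEQ_realpow_zero) auto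
    then have "eventually (\<lambda>k. (1 / 2 :: real) ^ k < d / 3) sequentially"
      using \<open>0 < d / 3\<close> by (rule order_tendstoD)
    with small_word_eventually[of l] small_word_eventually[of m]
    have "eventually (\<lambda>k. small_word k l = padded l \<and> small_word k m = padded m
        \<and> (1 / 2 :: real) ^ k < d / 3) sequentially"
      by (intro eventually_conj)
    then obtain K where K: "\<And>k. K \<le> k \<Longrightarrow> small_word k l = padded l \<and> small_word k m = padded m
        \<and> (1 / 2 :: real) ^ k < d / 3"
      unfolding eventually_sequentially by blast
    have "inj (\<lambda>t :: nat. to_nat (l, m, t))" by (rule injI) simp
    then have "infinite (range (\<lambda>t :: nat. to_nat (l, m, t)))" by (rule range_inj_infinite)
    then obtain t :: nat where t: "K \<le> to_nat (l, m, t)"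
      unfolding infinite_nat_iff_unbounded_le by blast
    define k where "k = to_nat (l, m, t)"
    have k: "a k = padded l" "b k = padded m" "1 / 2 ^ k < d / 3"
      using K[OF t] by (simp_all add: a_def b_def k_def power_divide)
    show "\<exists>k. \<forall>n\<in>hits k. dist ((doubled_shift ^^ n) x) u < d \<and> dist ((doubled_shift ^^ n) e) v < d"
    proof (intro exI ballI conjI)
      fix n assume n: "n \<in> hits k"
      show "dist ((doubled_shift ^^ n) x) u < d"
        by (rule approx[OF _ a_le a_supp n k(3) d]) (use l in \<open>simp_all add: x(2) k(1)\<close>)
      show "dist ((doubled_shift ^^ n) e) v < d"
        by (rule approx[OF _ b_le b_supp n k(3) d]) (use m in \<open>simp_all add: e(2) k(2)\<close>)
    qed
  qed (use x e in \<open>simp_all add: glue_def\<close>)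
qed

section \<open>Frequent but not dense d-hypercyclicity of the conjugated pair\<close>

lemma in_closure_of_meets:
  "x \<in> X closure_of S \<Longrightarrow> openin X U \<Longrightarrow> x \<in> U \<Longrightarrow> \<exists>y. y \<in> S \<and> y \<in> U"
  by (simp add: in_closure_of)

theorem theorem7p2:
  shows "\<exists>(X :: linf set) T1 T2. subspace X \<and> closed X \<and>
           bounded_linear_on X T1 \<and> bounded_linear_on X T2 \<and>
           d_frequently_hypercyclic X T1 T2 \<and> \<not> densely_d_hypercyclic X T1 T2"
proof -
  obtain x e where x: "x \<in> c0" "apply_bcontfun x 0 = 1" "apply_bcontfun x 1 = 0"
    and e: "e \<in> c0" "apply_bcontfun e 0 = 0" "apply_bcontfun e 1 = 0"
    and approx: "\<And>u v d. u \<in> c0 \<Longrightarrow> v \<in> c0 \<Longrightarrow> 0 < d \<Longrightarrow>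
      \<exists>k. \<forall>n\<in>hits k. dist ((doubled_shift ^^ n) x) u < d \<and> dist ((doubled_shift ^^ n) e) v < d"
    using frequently_approximating_pair by blast
  have "(\<lambda>i. (if i < 2 then 0 else \<bar>apply_bcontfun e i\<bar> + (1 / 2) ^ i)) \<longlonglongrightarrow> 0"
  proof (rule Lim_transform_eventually)
    have "(\<lambda>i. (1 / 2 :: real) ^ i) \<longlonglongrightarrow> 0" by (rule LIMSEQ_realpow_zero) auto
    then show "(\<lambda>i. \<bar>apply_bcontfun e i\<bar> + (1 / 2) ^ i) \<longlonglongrightarrow> 0"
      using e(1) unfolding c0_def by (intro tendsto_add_zero tendsto_rabs_zero) auto
    show "eventually (\<lambda>i. \<bar>apply_bcontfun e i\<bar> + (1 / 2) ^ i
        = (if i < 2 then 0 else \<bar>apply_bcontfun e i\<bar> + (1 / 2) ^ i)) sequentially"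
      using eventually_ge_at_top[of 2] by eventually_elim simp
  qed
  then obtain k where k: "k \<in> c0"
    "apply_bcontfun k = (\<lambda>i. (if i < 2 then 0 else \<bar>apply_bcontfun e i\<bar> + (1 / 2) ^ i))"
    by (rule null_seq_bcontfun)
  define S where "S = shear e k"
  define S' where "S' = shear (- e) (- k)"
  define T2 where "T2 y = S' (doubled_shift (S y))" for y
  have S_S': "S (S' y) = y" and S'_S: "S' (S y) = y" for y
    using shear_shear_minus[of e k y] e k(2) by (simp_all add: S_def S'_def)
  have bl_S: "bounded_linear S" and bl_S': "bounded_linear S'"
    by (simp_all add: S_def S'_def bounded_linear_shear)
  have S_c0: "S y \<in> c0" and S'_c0: "S' y \<in> c0" if "y \<in> c0" for y
    using that e(1) k(1) by (auto simp: S_def S'_def intro!: shear_c0 subspace_neg[OF subspace_c0])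
  have T2_funpow: "(T2 ^^ n) y = S' ((doubled_shift ^^ n) (S y))" for n y
    unfolding T2_def by (rule funpow_conjugate) (rule S_S' S'_S)+
  have T2_c0: "(T2 ^^ n) y \<in> c0" if "y \<in> c0" for n y
    using that by (simp add: T2_funpow S_c0 S'_c0 doubled_shift_funpow_c0)
  interpret Sn: bounded_linear "doubled_shift ^^ n" for n
    by (rule bounded_linear_doubled_shift_funpow)
  have "bounded_linear_on c0 T2"
    unfolding T2_def
    by (intro bounded_linear_on_if_bounded_linear bounded_linear_compose[OF bl_S']
        bounded_linear_compose[OF bounded_linear_doubled_shift bl_S])
      (auto intro: S_c0 S'_c0 doubled_shift_c0)
  moreover have "bounded_linear_on c0 doubled_shift"
    by (intro bounded_linear_on_if_bounded_linear bounded_linear_doubled_shift doubled_shift_c0)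
  moreover have "d_frequently_hypercyclic c0 doubled_shift T2"
    unfolding d_frequently_hypercyclic_def
  proof (intro bexI[OF _ x(1)] ballI)
    fix W :: "(linf \<times> linf) set"
    assume "W \<in> open_pair_sets c0"
    then have W: "openin (prod_topology (top_of_set c0) (top_of_set c0)) W" "W \<noteq> {}"
      by (simp_all add: open_pair_sets_def)
    from W(2) obtain u w where uw_W: "(u, w) \<in> W" by (metis ex_in_conv surj_pair)
    obtain U V where UV: "openin (top_of_set c0) U" "openin (top_of_set c0) V"
      "u \<in> U" "w \<in> V" "U \<times> V \<subseteq> W"
      using W(1)[unfolded openin_prod_topology_alt, rule_format, OF uw_W] by (elim exE conjE)
    then have uw: "u \<in> c0" "w \<in> c0" using openin_imp_subset by blast+
    obtain r where r: "0 < r" "\<And>y. y \<in> c0 \<Longrightarrow> dist y u < r \<Longrightarrow> y \<in> U"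
      using UV(1,3) unfolding openin_euclidean_subtopology_iff by blast
    obtain s where s: "0 < s" "\<And>y. y \<in> c0 \<Longrightarrow> dist y w < s \<Longrightarrow> y \<in> V"
      using UV(2,4) unfolding openin_euclidean_subtopology_iff by blast
    obtain K where K: "0 < K" "\<And>y. norm (S' y) \<le> norm y * K"
      using bounded_linear.pos_bounded[OF bl_S'] by blast
    \<comment> \<open>The first component then lands within \<open>r\<close> of \<open>u\<close>;
      the second has error below \<open>2 * d\<close> before \<open>S'\<close>, hence below
      \<open>s\<close> after it.\<close>
    define d where "d = min r (s / (2 * K))"
    have d: "0 < d" "d \<le> r" "2 * d * K \<le> s"
      using r(1) s(1) K(1) by (auto simp: d_def min_def field_simps)
    \<comment> \<open>For \<open>(T2 ^^ n) x\<close> to be near \<open>w\<close>, the sum of the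
      shifted \<open>x\<close> and \<open>e\<close> must be near \<open>S w\<close>; with
      \<open>x\<close> sent near \<open>u\<close>, this is the target left for
      \<open>e\<close>.\<close>
    have "S w - u \<in> c0" using uw S_c0 subspace_diff[OF subspace_c0] by blast
    then obtain l where l: "\<And>n. n \<in> hits l \<Longrightarrow>
        dist ((doubled_shift ^^ n) x) u < d \<and> dist ((doubled_shift ^^ n) e) (S w - u) < d"
      using approx[OF uw(1) _ d(1)] by blast
    have "((doubled_shift ^^ n) x, (T2 ^^ n) x) \<in> W" if n: "n \<in> hits l" for n
    proof -
      let ?x = "(doubled_shift ^^ n) x" and ?e = "(doubled_shift ^^ n) e"
      have "S x = x + e" using x by (simp add: S_def shear_def)
      then have "(T2 ^^ n) x = S' (?x + ?e)" by (simp add: T2_funpow Sn.add)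
      then have "(T2 ^^ n) x - w = S' (?x + ?e - S w)"
        by (simp add: bounded_linear.linear[OF bl_S'] linear_diff S'_S)
      also have "?x + ?e - S w = (?x - u) + (?e - (S w - u))" by simp
      finally have "dist ((T2 ^^ n) x) w \<le> norm ((?x - u) + (?e - (S w - u))) * K"
        using K(2) by (simp add: dist_norm)
      also have "\<dots> \<le> (norm (?x - u) + norm (?e - (S w - u))) * K"
        using K(1) by (intro mult_right_mono norm_triangle_ineq) auto
      also have "\<dots> < (2 * d) * K"
        using l[OF n] K(1) by (intro mult_strict_right_mono) (auto simp: dist_norm)
      finally have "(T2 ^^ n) x \<in> V" using d(3) x(1) by (intro s(2) T2_c0) auto
      moreover have "?x \<in> U" using l[OF n] d(2) x(1) by (intro r(2) doubled_shift_funpow_c0) auto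
      ultimately show ?thesis using UV(5) by blast
    qed
    then show "pos_lower_density {n. ((doubled_shift ^^ n) x, (T2 ^^ n) x) \<in> W}"
      by (intro pos_lower_density_hits) blast
  qed
  moreover have "\<not> densely_d_hypercyclic c0 doubled_shift T2"
  proof
    assume dense: "densely_d_hypercyclic c0 doubled_shift T2"
    let ?G = "{y \<in> c0. \<bar>apply_bcontfun y 0\<bar> < \<bar>apply_bcontfun y 1\<bar>}"
    have cont: "continuous_on c0 (\<lambda>y. apply_bcontfun y i)" for i
      by (rule linear_continuous_on[OF bounded_linear_apply_bcontfun])
    \<comment> \<open>The unit vector at 1 shows that the open set \<open>?G\<close> is
      nonempty.\<close>
    have "(\<lambda>i. if i = 1 then 1 else 0 :: real) \<longlonglongrightarrow> 0"
      by (rule tendsto_eventually) (auto simp: eventually_sequentially intro: exI[of _ 2])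
    then obtain y1 where y1: "y1 \<in> c0" "apply_bcontfun y1 = (\<lambda>i. if i = 1 then 1 else 0)"
      by (rule null_seq_bcontfun)
    have openin_G: "openin (top_of_set c0) ?G"
    proof -
      have "openin (top_of_set c0) (c0 \<inter> (\<lambda>y. \<bar>apply_bcontfun y 1\<bar> - \<bar>apply_bcontfun y 0\<bar>) -` {0<..})"
        by (intro continuous_openin_preimage_gen continuous_intros cont)
      also have "c0 \<inter> (\<lambda>y. \<bar>apply_bcontfun y 1\<bar> - \<bar>apply_bcontfun y 0\<bar>) -` {0<..} = ?G" by auto
      finally show ?thesis .
    qed
    have "y1 \<in> ?G" using y1 by simp
    have "y1 \<in> (top_of_set c0) closure_of {y. d_hypercyclic_vector c0 doubled_shift T2 y}"
      using dense y1(1) by (simp add: densely_d_hypercyclic_def)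
    from in_closure_of_meets[OF this openin_G \<open>y1 \<in> ?G\<close>]
    obtain y where "y \<in> {y. d_hypercyclic_vector c0 doubled_shift T2 y}" "y \<in> ?G"
      by (elim exE conjE)
    then have y: "d_hypercyclic_vector c0 doubled_shift T2 y" "y \<in> ?G" by simp_all
    define c where "c = \<bar>apply_bcontfun y 1\<bar>"
    have c: "0 < c" using y(2) by (auto simp: c_def)
    have lower: "c / 4 \<le> norm ((doubled_shift ^^ n) (S y - y))" for n
    proof -
      \<comment> \<open>A single coordinate suffices: \<open>m\<close> is at least \<open>n\<close>,
        so it survives the shift; at least 2, where \<open>k\<close> exceeds the modulus of
        \<open>e\<close>; and at most \<open>n + 2\<close>, which yields the factor 1/4.\<close>
      define m where "m = max n 2"
      have "\<bar>apply_bcontfun y 0 * apply_bcontfun e m\<bar> \<le> c * \<bar>apply_bcontfun e m\<bar>"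
        using y(2) by (simp add: c_def abs_mult mult_right_mono)
      moreover have "\<bar>apply_bcontfun y 1 * apply_bcontfun k m\<bar>
          = c * \<bar>apply_bcontfun e m\<bar> + c * (1 / 2) ^ m"
      proof -
        have "apply_bcontfun k m = \<bar>apply_bcontfun e m\<bar> + (1 / 2) ^ m"
          by (simp add: k(2) m_def)
        then have "\<bar>apply_bcontfun k m\<bar> = \<bar>apply_bcontfun e m\<bar> + (1 / 2) ^ m"
          by (metis abs_of_nonneg abs_ge_zero add_nonneg_nonneg zero_le_power zero_le_divide_1_iff zero_le_numeral)
        then show ?thesis by (simp only: abs_mult c_def distrib_left)
      qed
      moreover have "apply_bcontfun (S y - y) m
          = apply_bcontfun y 0 * apply_bcontfun e m + apply_bcontfun y 1 * apply_bcontfun k m"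
        by (simp add: S_def apply_shear minus_bcontfun.rep_eq)
      ultimately have "c * (1 / 2) ^ m \<le> \<bar>apply_bcontfun (S y - y) m\<bar>" by linarith
      then have "2 ^ n * (c * (1 / 2) ^ m) \<le> 2 ^ n * \<bar>apply_bcontfun (S y - y) m\<bar>"
        by simp
      also have "\<dots> = norm (apply_bcontfun ((doubled_shift ^^ n) (S y - y)) (m - n))"
        by (simp add: apply_doubled_shift_funpow m_def abs_mult)
      also have "\<dots> \<le> norm ((doubled_shift ^^ n) (S y - y))" by (rule norm_bounded)
      finally have "c * (2 ^ n * (1 / 2) ^ m) \<le> norm ((doubled_shift ^^ n) (S y - y))"
        by (simp add: mult.left_commute)
      moreover have "(1 / 4 :: real) \<le> 2 ^ n * (1 / 2) ^ m"
      proof -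
        have "(2::real) ^ m \<le> 2 ^ (n + 2)" by (rule power_increasing) (auto simp: m_def)
        then show ?thesis by (simp add: power_divide field_simps)
      qed
      then have "c * (1 / 4) \<le> c * (2 ^ n * (1 / 2) ^ m)" using c by (intro mult_left_mono) auto
      ultimately show ?thesis by simp
    qed
    obtain K where K: "0 < K" "\<And>y. norm (S y) \<le> norm y * K"
      using bounded_linear.pos_bounded[OF bl_S] by blast
    \<comment> \<open>Chosen so that two orbit points in the ball of radius \<open>d\<close> force
      the vector bounded in \<open>lower\<close> strictly below \<open>c / 4\<close>.\<close>
    define d where "d = c / 4 / (K + 1)"
    have d: "0 < d" "d * K + d = c / 4"
    proof -
      show "0 < d" using c K(1) by (simp add: d_def)
      have "d * (K + 1) = c / 4"
        unfolding d_def by (rule nonzero_eq_divide_eq[THEN iffD1]) (use K(1) in auto)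
      then show "d * K + d = c / 4" by (simp only: distrib_left mult_1_right)
    qed
    let ?B = "c0 \<inter> ball 0 d"
    have "openin (top_of_set c0) ?B" by (simp add: openin_open_Int)
    then have openin_B: "openin (prod_topology (top_of_set c0) (top_of_set c0)) (?B \<times> ?B)"
      by (simp only: openin_prod_Times_iff simp_thms)
    have zero: "0 \<in> c0" by (rule subspace_0[OF subspace_c0])
    then have zero_B: "(0, 0) \<in> ?B \<times> ?B" using d(1) by simp
    have "(0, 0) \<in> prod_topology (top_of_set c0) (top_of_set c0) closure_of
        {((doubled_shift ^^ n) y, (T2 ^^ n) y) | n. True}"
      using y(1) zero by (simp add: d_hypercyclic_vector_def)
    from in_closure_of_meets[OF this openin_B zero_B]
    obtain n where n: "(doubled_shift ^^ n) y \<in> ball 0 d" "(T2 ^^ n) y \<in> ball 0 d"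
      by auto
    \<comment> \<open>Conjugation turns joint smallness of the two orbits of \<open>y\<close> into
      smallness of the single orbit of \<open>S y - y\<close>.\<close>
    have "(doubled_shift ^^ n) (S y - y) = S ((T2 ^^ n) y) - (doubled_shift ^^ n) y"
      by (simp add: T2_funpow S_S' Sn.diff)
    then have "norm ((doubled_shift ^^ n) (S y - y)) \<le> norm (S ((T2 ^^ n) y)) + norm ((doubled_shift ^^ n) y)"
      by (simp add: norm_triangle_ineq4)
    also have "\<dots> \<le> norm ((T2 ^^ n) y) * K + norm ((doubled_shift ^^ n) y)" using K(2) by simp
    also have "\<dots> < d * K + d" using n K(1) by (intro add_strict_mono mult_strict_right_mono) auto
    finally show False using lower[of n] d(2) by simp
  qed
  ultimately show ?thesis using subspace_c0 closed_c0 by blast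
qed

end
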